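(* Let $G = G_1 \oplus_{v_1} G_0 \oplus_{v_2} G_2$, where $G_1$ and $G_2$ are connected graphs each on at least $2$ vertices, $G_0$ is a graph containing vertices $v_1$ and $v_2$ (possibly $v_1 = v_2$), $v_1 \in V(G_1)$ and $v_2 \in V(G_2)$. Let $i \in V(G_0)$. Then \[ \xi\xi(G,i) = \max\{\xi\xi(K_2 \oplus_{v_1} G_0 \oplus_{v_2} G_2,\ i),\ \xi\xi(G_1 \oplus_{v_1} G_0 \oplus_{v_2} K_2,\ i)\}, \] where in each case $K_2$ is an edge one of whose endpoints is labeled $v_1$ (respectively $v_2$).
   Context: All graphs are finite and simple. The vertex sum $H_1 \oplus_v H_2$ of graphs each having a vertex labeled $v$ is obtained by identifying the two vertices labeled $v$, all other vertices remaining distinct. For a graph $G$ on $n$ vertices labeled $1,\dots,n$, $\mathcal{S}(G)$ is the set of $n\times n$ real symmetric matrices whose off-diagonal $(p,q)$-entry is nonzero iff $\{p,q\}\in E(G)$ (diagonal arbitrary). $A(i)$ is $A$ with row and column $i$ deleted; $(AX)(i,:]$ is $AX$ with row $i$ deleted; $\circ$ is the entrywise product. The $i$-nullity pair of $A$ is $(\operatorname{null}(A),\operatorname{null}(A(i)))$. A symmetric $A$ has $i$-SNIP if the only symmetric $X$ with $A\circ X=O$, $I\circ X=O$, $(AX)(i,:]=O$ is $X=O$. For a rooted graph $(G,i)$, $\xi\xi(G,i)$ is the maximum of $k+\ell$ over pairs $(k,\ell)$ with $k\le\ell$ such that some $A\in\mathcal{S}(G)$ with $i$-SNIP has $i$-nullity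 pair $(k,\ell)$. *)

theory Defs
  imports
    "Graph_Theory.Graph_Theory"
    "HOL-Library.Function_Algebras"
    "HOL-Analysis.Analysis"
begin

text \<open>
  A finite simple graph is a \<open>pair_graph\<close>: finite, symmetric, loop-free, with at most one arc per
  ordered pair; the undirected edge \<open>{p, q}\<close> is the pair of arcs \<open>(p, q)\<close>, \<open>(q, p)\<close>.

  A matrix whose rows and columns are indexed by a finite set \<open>V\<close> is a function
  \<open>'a \<Rightarrow> 'a \<Rightarrow> real\<close> of which only the entries on \<open>V \<times> V\<close> are ever inspected. The submatrix
  \<open>A(i)\<close> is the same function read on the index set \<open>V - {i}\<close>.
\<close>

definition fun_scale :: "real \<Rightarrow> ('a \<Rightarrow> real) \<Rightarrow> 'a \<Rightarrow> real" where
  "fun_scale c x = (\<lambda>p. c * x p)"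

interpretation fun_space: vector_space "fun_scale :: real \<Rightarrow> ('a \<Rightarrow> real) \<Rightarrow> 'a \<Rightarrow> real"
  by unfold_locales (auto simp: fun_scale_def algebra_simps)

text \<open>Vectors indexed by \<open>V\<close> are the functions vanishing outside \<open>V\<close>.\<close>

definition null_space :: "'a set \<Rightarrow> ('a \<Rightarrow> 'a \<Rightarrow> real) \<Rightarrow> ('a \<Rightarrow> real) set" where
  "null_space V A =
     {x. (\<forall>p. p \<notin> V \<longrightarrow> x p = 0) \<and> (\<forall>p\<in>V. (\<Sum>q\<in>V. A p q * x q) = 0)}"

definition nullity :: "'a set \<Rightarrow> ('a \<Rightarrow> 'a \<Rightarrow> real) \<Rightarrow> nat" where
  "nullity V A = fun_space.dim (null_space V A)"

definition nullity_pair :: "'a set \<Rightarrow> 'a \<Rightarrow> ('a \<Rightarrow> 'a \<Rightarrow> real) \<Rightarrow> nat \<times> nat" where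
  "nullity_pair V i A = (nullity V A, nullity (V - {i}) A)"

definition symmetric_on :: "'a set \<Rightarrow> ('a \<Rightarrow> 'a \<Rightarrow> real) \<Rightarrow> bool" where
  "symmetric_on V A \<longleftrightarrow> (\<forall>p\<in>V. \<forall>q\<in>V. A p q = A q p)"

definition graph_matrices :: "'a pair_pre_digraph \<Rightarrow> ('a \<Rightarrow> 'a \<Rightarrow> real) set" where
  "graph_matrices G =
     {A. symmetric_on (pverts G) A \<and>
         (\<forall>p\<in>pverts G. \<forall>q\<in>pverts G. p \<noteq> q \<longrightarrow> (A p q \<noteq> 0 \<longleftrightarrow> (p, q) \<in> parcs G))}"

text \<open>
  The three hypotheses on \<open>X\<close> are, in order, \<open>A \<circ> X = O\<close>, \<open>I \<circ> X = O\<close> (that is, \<open>X\<close> has zero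
  diagonal), and that \<open>A X\<close> with row \<open>i\<close> deleted (all columns kept) is zero.
\<close>

definition SNIP :: "'a set \<Rightarrow> 'a \<Rightarrow> ('a \<Rightarrow> 'a \<Rightarrow> real) \<Rightarrow> bool" where
  "SNIP V i A \<longleftrightarrow>
     (\<forall>X. symmetric_on V X \<and>
          (\<forall>p\<in>V. \<forall>q\<in>V. A p q * X p q = 0) \<and>
          (\<forall>p\<in>V. X p p = 0) \<and>
          (\<forall>p\<in>V - {i}. \<forall>q\<in>V. (\<Sum>r\<in>V. A p r * X r q) = 0)
        \<longrightarrow> (\<forall>p\<in>V. \<forall>q\<in>V. X p q = 0))"

definition SNIP_sums :: "'a pair_pre_digraph \<Rightarrow> 'a \<Rightarrow> nat set" where
  "SNIP_sums G i =
     {k + l | k l. k \<le> l \<and>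
        (\<exists>A\<in>graph_matrices G. SNIP (pverts G) i A \<and> nullity_pair (pverts G) i A = (k, l))}"

definition xixi :: "'a pair_pre_digraph \<Rightarrow> 'a \<Rightarrow> nat" where
  "xixi G i = Max (SNIP_sums G i)"

text \<open>
  The maximum is taken over a finite nonempty set: a nullity is at most the size of the index set,
  and every strictly diagonally dominant matrix has the SNIP with nullity pair \<open>(0, 0)\<close>.
\<close>

lemma nullity_le_card:
  assumes "finite V"
  shows "nullity V A \<le> card V"
proof -
  define e where "e p = (\<lambda>q. if q = p then 1 else 0 :: real)" for p :: 'a
  have "x \<in> fun_space.span (e ` V)" if "x \<in> null_space V A" for x
  proof -
    have "x = (\<Sum>p\<in>V. fun_scale (x p) (e p))"
    proof
      fix q
      have "(\<Sum>p\<in>V. fun_scale (x p) (e p)) q = (\<Sum>p\<in>V. fun_scale (x p) (e p) q)"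
        using assms by (induction V rule: finite_induct) auto
      also have "\<dots> = (\<Sum>p\<in>V. if p = q then x p else 0)"
        by (intro sum.cong) (auto simp: fun_scale_def e_def)
      also have "\<dots> = x q"
        using assms that by (auto simp: null_space_def)
      finally show "x q = (\<Sum>p\<in>V. fun_scale (x p) (e p)) q" by simp
    qed
    moreover have "(\<Sum>p\<in>V. fun_scale (x p) (e p)) \<in> fun_space.span (e ` V)"
      by (intro fun_space.span_sum fun_space.span_scale fun_space.span_base) auto
    ultimately show ?thesis by simp
  qed
  then have "nullity V A \<le> card (e ` V)"
    unfolding nullity_def using assms by (intro fun_space.dim_le_card) auto
  also have "\<dots> \<le> card V" by (rule card_image_le[OF assms])
  finally show ?thesis .
qed

lemma diag_dominant_null:
  assumes "finite V" and dom: "\<And>p. p \<in> V \<Longrightarrow> (\<Sum>q\<in>V - {p}. \<bar>A p q\<bar>) < \<bar>A p p\<bar>"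
    and eq: "\<And>p. p \<in> V \<Longrightarrow> (\<Sum>q\<in>V. A p q * x q) = 0" and "p \<in> V"
  shows "x p = (0::real)"
proof (rule ccontr)
  assume nz: "x p \<noteq> 0"
  define M where "M = Max ((\<lambda>q. \<bar>x q\<bar>) ` V)"
  have M: "\<bar>x q\<bar> \<le> M" if "q \<in> V" for q
    using assms(1) that by (auto simp: M_def)
  have "M \<in> (\<lambda>q. \<bar>x q\<bar>) ` V"
    unfolding M_def using assms(1) \<open>p \<in> V\<close> by (intro Max_in) auto
  then obtain m where m: "m \<in> V" "\<bar>x m\<bar> = M" by auto
  have pos: "M > 0" using M[OF \<open>p \<in> V\<close>] nz by auto
  have "A m m * x m = - (\<Sum>q\<in>V - {m}. A m q * x q)"
    using eq[OF m(1)] sum.remove[OF assms(1) m(1), of "\<lambda>q. A m q * x q"] by simp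
  then have "\<bar>A m m\<bar> * M = \<bar>\<Sum>q\<in>V - {m}. A m q * x q\<bar>"
    using m(2) by (metis abs_minus_cancel abs_mult)
  also have "\<dots> \<le> (\<Sum>q\<in>V - {m}. \<bar>A m q * x q\<bar>)" by (rule sum_abs)
  also have "\<dots> \<le> (\<Sum>q\<in>V - {m}. \<bar>A m q\<bar> * M)"
    by (intro sum_mono) (auto simp: abs_mult intro!: mult_left_mono M)
  also have "\<dots> = (\<Sum>q\<in>V - {m}. \<bar>A m q\<bar>) * M" by (simp add: sum_distrib_right)
  also have "\<dots> < \<bar>A m m\<bar> * M" using dom[OF m(1)] pos by (intro mult_strict_right_mono)
  finally show False by simp
qed

lemma finite_SNIP_sums:
  assumes "pair_graph G"
  shows "finite (SNIP_sums G i)"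
proof -
  interpret pair_graph G by (rule assms)
  have fin: "finite (pverts G)" by (rule pair_finite_verts)
  have "SNIP_sums G i \<subseteq> {..card (pverts G) + card (pverts G - {i})}"
    using nullity_le_card[OF fin] nullity_le_card[OF finite_Diff[OF fin]]
    by (fastforce simp: SNIP_sums_def nullity_pair_def intro: add_mono)
  then show ?thesis using finite_subset by blast
qed

lemma SNIP_sums_nonempty:
  assumes "pair_graph G" and i: "i \<in> pverts G"
  shows "0 \<in> SNIP_sums G i"
proof -
  interpret pair_graph G by (rule assms)
  define V where "V = pverts G"
  have fin: "finite V" unfolding V_def by (rule pair_finite_verts)
  define A where "A p q = (if p = q then real (card V) + 1
    else if (p, q) \<in> parcs G then 1 else 0)" for p q
  have dom: "(\<Sum>q\<in>W - {p}. \<bar>A p q\<bar>) < \<bar>A p p\<bar>" if "W \<subseteq> V" for W p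
  proof -
    have "(\<Sum>q\<in>W - {p}. \<bar>A p q\<bar>) \<le> (\<Sum>q\<in>W - {p}. 1)"
      by (intro sum_mono) (auto simp: A_def)
    also have "\<dots> \<le> real (card V)"
      using card_mono[OF fin, of "W - {p}"] that by auto
    finally show ?thesis by (simp add: A_def)
  qed
  have nullity0: "nullity W A = 0" if "W \<subseteq> V" for W
  proof -
    have "null_space W A \<subseteq> {0}"
      using diag_dominant_null[OF finite_subset[OF that fin] dom[OF that]]
      by (fastforce simp: null_space_def fun_eq_iff)
    then have "nullity W A \<le> card ({} :: ('a \<Rightarrow> real) set)"
      unfolding nullity_def by (intro fun_space.dim_le_card) auto
    then show ?thesis by simp
  qed
  have "SNIP V i A"
    unfolding SNIP_def
  proof (intro allI impI, elim conjE)
    fix X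
    assume sym: "symmetric_on V X" and diag: "\<forall>p\<in>V. X p p = 0"
      and AX: "\<forall>p\<in>V - {i}. \<forall>q\<in>V. (\<Sum>r\<in>V. A p r * X r q) = 0"
    have col: "X p q = 0" if "X i q = 0" "p \<in> V" "q \<in> V" for p q
    proof (cases "p = i")
      case False
      have "X p q = 0"
      proof (rule diag_dominant_null[where V = "V - {i}" and A = A and x = "\<lambda>r. X r q"])
        fix s assume s: "s \<in> V - {i}"
        have "(\<Sum>r\<in>V. A s r * X r q) = (\<Sum>r\<in>V - {i}. A s r * X r q)"
          using sum.remove[OF fin, of i "\<lambda>r. A s r * X r q"] i that(1) by (simp add: V_def)
        then show "(\<Sum>r\<in>V - {i}. A s r * X r q) = 0" using AX s that(3) by simp
      qed (use fin dom[of "V - {i}"] that(2) False in auto)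
      then show ?thesis .
    qed (use that in simp)
    have "X i q = 0" if "q \<in> V" for q
      using col[of i q] diag sym i that unfolding symmetric_on_def V_def by metis
    then show "\<forall>p\<in>V. \<forall>q\<in>V. X p q = 0" using col by blast
  qed
  moreover have "A \<in> graph_matrices G"
    using pair_sym_arcs
    by (auto simp: graph_matrices_def symmetric_on_def A_def symmetric_def dest: symD)
  moreover have "nullity_pair V i A = (0, 0)"
    by (auto simp: nullity_pair_def nullity0)
  ultimately show ?thesis
    unfolding SNIP_sums_def V_def by force
qed

text \<open>
  Vertices are identified by name, so \<open>G\<close> is the vertex sum of \<open>H\<^sub>1\<close> and \<open>H\<^sub>2\<close> at \<open>v\<close> if it is
  their union and \<open>v\<close> is the only vertex name they have in common.
\<close>

definition is_vertex_sum ::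
  "'a pair_pre_digraph \<Rightarrow> 'a \<Rightarrow> 'a pair_pre_digraph \<Rightarrow> 'a pair_pre_digraph \<Rightarrow> bool" where
  "is_vertex_sum H\<^sub>1 v H\<^sub>2 G \<longleftrightarrow>
     pverts H\<^sub>1 \<inter> pverts H\<^sub>2 = {v} \<and>
     G = \<lparr>pverts = pverts H\<^sub>1 \<union> pverts H\<^sub>2, parcs = parcs H\<^sub>1 \<union> parcs H\<^sub>2\<rparr>"

text \<open>
  \<open>G = (H\<^sub>1 \<oplus>\<^bsub>v\<^sub>1\<^esub> H\<^sub>0) \<oplus>\<^bsub>v\<^sub>2\<^esub> H\<^sub>2\<close>, where \<open>v\<^sub>1 = v\<^sub>2\<close> is allowed. The requirement \<open>v\<^sub>2 \<in> V(H\<^sub>0)\<close>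
  makes \<open>H\<^sub>2\<close> attach to \<open>H\<^sub>0\<close>, and not to another vertex of \<open>H\<^sub>1\<close>.
\<close>

definition is_double_vertex_sum ::
  "'a pair_pre_digraph \<Rightarrow> 'a \<Rightarrow> 'a pair_pre_digraph \<Rightarrow> 'a \<Rightarrow> 'a pair_pre_digraph
     \<Rightarrow> 'a pair_pre_digraph \<Rightarrow> bool" where
  "is_double_vertex_sum H\<^sub>1 v\<^sub>1 H\<^sub>0 v\<^sub>2 H\<^sub>2 G \<longleftrightarrow>
     v\<^sub>1 \<in> pverts H\<^sub>0 \<and> v\<^sub>2 \<in> pverts H\<^sub>0 \<and>
     (\<exists>H. is_vertex_sum H\<^sub>1 v\<^sub>1 H\<^sub>0 H \<and> is_vertex_sum H v\<^sub>2 H\<^sub>2 G)"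

end

theory Submission
  imports Defs
begin

text \<open>
  Let \<open>W = V(G\<^sub>1) - {v\<^sub>1}\<close>. A vector on \<open>V(G\<^sub>1)\<close> annihilated by the rows of \<open>A\<close> in \<open>W\<close> interacts with the
  rest of \<open>G\<close> only through its value at \<open>v\<^sub>1\<close> and its contribution (the \<^emph>\<open>outflow\<close>) to row \<open>v\<^sub>1\<close>. If no
  nonzero such vector has both equal to \<open>0\<close>, then, by symmetry of \<open>A\<close>, these vectors form a line, and the
  nullities and the SNIP depend only on the ratio of value and outflow on that line. Every ratio occurs
  on every graph in which \<open>v\<^sub>1\<close> has a neighbour, so \<open>G\<^sub>1\<close> may be exchanged for \<open>K\<^sub>2\<close> and back. If the
  condition failed for both \<open>G\<^sub>1\<close> and \<open>G\<^sub>2\<close>, the two null vectors \<open>x\<close>, \<open>y\<close> would violate the SNIP via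
  \<open>X = x y\<^sup>T + y x\<^sup>T\<close>. Hence the nullity sums attained by \<open>G\<close> are exactly those attained by one of the two
  graphs on the right.
\<close>

section \<open>Solutions on a branch and their transfer to another branch\<close>

definition branch_solution :: "'a set \<Rightarrow> 'a \<Rightarrow> ('a \<Rightarrow> 'a \<Rightarrow> real) \<Rightarrow> ('a \<Rightarrow> real) \<Rightarrow> bool" where
  "branch_solution W v A y \<longleftrightarrow> (\<forall>p\<in>W. (\<Sum>q\<in>insert v W. A p q * y q) = 0)"

definition outflow :: "'a set \<Rightarrow> 'a \<Rightarrow> ('a \<Rightarrow> 'a \<Rightarrow> real) \<Rightarrow> ('a \<Rightarrow> real) \<Rightarrow> real" where
  "outflow W v A y = (\<Sum>q\<in>insert v W. A v q * y q)"

definition branch_generator :: "'a set \<Rightarrow> 'a \<Rightarrow> ('a \<Rightarrow> 'a \<Rightarrow> real) \<Rightarrow> ('a \<Rightarrow> real) \<Rightarrow> bool" where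
  "branch_generator W v A z \<longleftrightarrow>
     branch_solution W v A z \<and> (\<exists>q\<in>insert v W. z q \<noteq> 0) \<and>
     (\<forall>y. branch_solution W v A y \<longrightarrow> (\<exists>c. \<forall>q\<in>insert v W. y q = c * z q))"

text \<open>The quotient is read off at one fixed index, so it is defined for every \<open>y\<close>
  and linear in it, even where \<open>y\<close> is no multiple of \<open>z\<close>; hence
  \<open>exchange\<close> is linear on the whole function space.\<close>

definition branch_coeff :: "'a set \<Rightarrow> 'a \<Rightarrow> ('a \<Rightarrow> real) \<Rightarrow> ('a \<Rightarrow> real) \<Rightarrow> real" where
  "branch_coeff W v z y =
     (let q = (SOME q. q \<in> insert v W \<and> z q \<noteq> 0) in y q / z q)"

lemma branch_coeff_eqI:
  assumes "\<exists>q\<in>insert v W. z q \<noteq> 0" and "\<And>q. q \<in> insert v W \<Longrightarrow> y q = c * z q"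
  shows "branch_coeff W v z y = c"
proof -
  define q where "q = (SOME q. q \<in> insert v W \<and> z q \<noteq> 0)"
  have "q \<in> insert v W \<and> z q \<noteq> 0"
    unfolding q_def by (rule someI_ex) (use assms(1) in blast)
  then show ?thesis
    using assms(2)[of q] unfolding branch_coeff_def q_def[symmetric] Let_def by simp
qed

text \<open>The value at \<open>v\<close> is copied along with \<open>R\<close>, which agrees with
  the multiple of \<open>z'\<close> there when \<open>z v = z' v\<close>.\<close>

definition exchange ::
  "'a set \<Rightarrow> 'a set \<Rightarrow> 'a set \<Rightarrow> 'a \<Rightarrow> ('a \<Rightarrow> real) \<Rightarrow> ('a \<Rightarrow> real) \<Rightarrow> ('a \<Rightarrow> real) \<Rightarrow> 'a \<Rightarrow> real"
where
  "exchange R W W' v z z' x =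
     (\<lambda>q. if q \<in> R then x q else if q \<in> W' then branch_coeff W v z x * z' q else 0)"

lemma exchange_linear: "Vector_Spaces.linear fun_scale fun_scale (exchange R W W' v z z')"
  by unfold_locales
    (auto simp: exchange_def fun_scale_def branch_coeff_def Let_def fun_eq_iff
      algebra_simps add_divide_distrib)

lemma null_space_subspace: "fun_space.subspace (null_space V A)"
  by (auto simp: fun_space.subspace_def null_space_def fun_scale_def algebra_simps
      sum.distrib simp flip: sum_distrib_left)

lemma dim_inj_image:
  assumes lin: "Vector_Spaces.linear fun_scale fun_scale f"
    and sub: "fun_space.subspace N" and inj: "inj_on f N"
  shows "fun_space.dim (f ` N) = fun_space.dim N"
proof -
  interpret f: Vector_Spaces.linear fun_scale fun_scale f by (rule lin)
  obtain B where B: "B \<subseteq> N" "fun_space.independent B" "N \<subseteq> fun_space.span B"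
      "card B = fun_space.dim N"
    using fun_space.basis_exists by blast
  have span: "fun_space.span B = N"
    using B sub by (simp add: fun_space.span_minimal subset_antisym)
  have "fun_space.independent (f ` B)"
    using f.independent_injective_image[OF B(2)] inj span by simp
  moreover have "fun_space.span (f ` B) = fun_space.span (f ` N)"
    using span sub by (metis f.span_image fun_space.span_span)
  moreover have "card (f ` B) = card B"
    using inj_on_subset[OF inj B(1)] by (rule card_image)
  ultimately show ?thesis using fun_space.dim_eq_card B(4) by metis
qed

text \<open>A vector supported on \<open>V - I\<close> does not see the columns in \<open>I\<close>,
  so row sums may run over all of \<open>V\<close>. This treats \<open>A\<close> (with
  \<open>I = {}\<close>) and \<open>A(i)\<close> (with \<open>I = {i}\<close>) by the same
  formulas.\<close>

lemma null_space_Diff: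
  assumes "finite V"
  shows "x \<in> null_space (V - I) A \<longleftrightarrow>
    (\<forall>p. p \<notin> V - I \<longrightarrow> x p = 0) \<and> (\<forall>p\<in>V - I. (\<Sum>q\<in>V. A p q * x q) = 0)"
proof -
  have "(\<Sum>q\<in>V. A p q * x q) = (\<Sum>q\<in>V - I. A p q * x q)" if "\<forall>p. p \<notin> V - I \<longrightarrow> x p = 0" for p
    by (rule sum.mono_neutral_right) (use assms that in auto)
  then show ?thesis unfolding null_space_def by auto
qed

section \<open>Exchanging one branch: nullities and the SNIP\<close>

lemma SNIP_D:
  assumes "SNIP V i A" and "symmetric_on V X"
    and "\<And>p q. p \<in> V \<Longrightarrow> q \<in> V \<Longrightarrow> A p q * X p q = 0"
    and "\<And>p. p \<in> V \<Longrightarrow> X p p = 0"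
    and "\<And>p q. p \<in> V - {i} \<Longrightarrow> q \<in> V \<Longrightarrow> (\<Sum>r\<in>V. A p r * X r q) = 0"
    and "p \<in> V" and "q \<in> V"
  shows "X p q = 0"
  using spec[OF assms(1)[unfolded SNIP_def], of X] assms(2-) by blast

text \<open>The entry at \<open>(v, v)\<close> may differ between \<open>A\<close> and
  \<open>A'\<close>: it is counted inside the outflow, and the rows in \<open>R\<close> detect a
  branch only through the value at \<open>v\<close> and the outflow. The assumptions are symmetric
  in the two branches, so each result holds in both directions through \<open>flip\<close>.\<close>

locale branch_exchange =
  fixes R W W' :: "'a set" and v :: 'a and A A' :: "'a \<Rightarrow> 'a \<Rightarrow> real" and z z' :: "'a \<Rightarrow> real"
  assumes finite: "finite R" "finite W" "finite W'"
    and v: "v \<in> R"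
    and disjoint: "R \<inter> W = {}" "R \<inter> W' = {}"
    and cut: "\<And>p q. p \<in> W \<Longrightarrow> q \<in> R - {v} \<Longrightarrow> A p q = 0 \<and> A q p = 0"
    and cut': "\<And>p q. p \<in> W' \<Longrightarrow> q \<in> R - {v} \<Longrightarrow> A' p q = 0 \<and> A' q p = 0"
    and agree: "\<And>p q. p \<in> R \<Longrightarrow> q \<in> R \<Longrightarrow> (p, q) \<noteq> (v, v) \<Longrightarrow> A p q = A' p q"
    and generator: "branch_generator W v A z"
    and generator': "branch_generator W' v A' z'"
    and z_v: "z v = z' v"
    and outflow: "outflow W v A z = outflow W' v A' z'"
begin

lemma flip: "branch_exchange R W' W v A' A z' z"
  by unfold_locales
    (use finite v disjoint cut cut' agree generator generator' z_v outflow in auto)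

lemma sum_split:
  fixes f :: "'a \<Rightarrow> real"
  shows "sum f (R \<union> W) = sum f (R - {v}) + sum f (insert v W)"
proof -
  have "R \<union> W = (R - {v}) \<union> insert v W" using v by auto
  then show ?thesis
    using sum.union_disjoint[of "R - {v}" "insert v W" f] finite disjoint by auto
qed

lemma z_nonzero: "\<exists>q\<in>insert v W. z q \<noteq> 0"
  using generator by (simp add: branch_generator_def)

lemma row_in_branch:
  assumes "p \<in> W"
  shows "(\<Sum>q\<in>R \<union> W. A p q * x q) = (\<Sum>q\<in>insert v W. A p q * x q)"
  unfolding sum_split using cut[OF assms] by simp

lemma row_in_branch_zero:
  assumes "\<And>q. q \<in> insert v W \<Longrightarrow> x q = c * z q" and "p \<in> W"
  shows "(\<Sum>q\<in>R \<union> W. A p q * x q) = 0"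
proof -
  have "(\<Sum>q\<in>R \<union> W. A p q * x q) = c * (\<Sum>q\<in>insert v W. A p q * z q)"
    unfolding row_in_branch[OF assms(2)] sum_distrib_left
    by (intro sum.cong) (auto simp: assms(1))
  then show ?thesis
    using generator assms(2) by (simp add: branch_generator_def branch_solution_def)
qed

lemma coeff:
  assumes "\<And>p. p \<in> W \<Longrightarrow> (\<Sum>q\<in>R \<union> W. A p q * x q) = 0" and "q \<in> insert v W"
  shows "x q = branch_coeff W v z x * z q"
proof -
  have "branch_solution W v A x"
    using assms(1) by (simp add: branch_solution_def row_in_branch)
  then obtain c where c: "\<And>q. q \<in> insert v W \<Longrightarrow> x q = c * z q"
    using generator unfolding branch_generator_def by blast
  show ?thesis using branch_coeff_eqI[OF z_nonzero c] c assms(2) by blast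
qed

text \<open>A row other than \<open>v\<close> meets the branch only in column \<open>v\<close>; row
  \<open>v\<close> receives \<open>c\<close> times the outflow of the generator. Both are the same
  for the two branches.\<close>

lemma row_outside_branch:
  assumes "\<And>q. q \<in> R \<Longrightarrow> x' q = x q" and "\<And>q. q \<in> insert v W \<Longrightarrow> x q = c * z q"
    and "\<And>q. q \<in> insert v W' \<Longrightarrow> x' q = c * z' q" and "p \<in> R"
  shows "(\<Sum>q\<in>R \<union> W'. A' p q * x' q) = (\<Sum>q\<in>R \<union> W. A p q * x q)"
proof -
  interpret f: branch_exchange R W' W v A' A z' z by (rule flip)
  have rest: "(\<Sum>q\<in>R - {v}. A' p q * x' q) = (\<Sum>q\<in>R - {v}. A p q * x q)"
    using assms(1,4) agree by (intro sum.cong) auto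
  have "(\<Sum>q\<in>insert v W'. A' p q * x' q) = (\<Sum>q\<in>insert v W. A p q * x q)"
  proof (cases "p = v")
    case True
    have "(\<Sum>q\<in>insert v W'. A' p q * x' q) = c * outflow W' v A' z'"
      unfolding outflow_def sum_distrib_left using True
      by (intro sum.cong) (auto simp: assms(3))
    moreover have "(\<Sum>q\<in>insert v W. A p q * x q) = c * outflow W v A z"
      unfolding outflow_def sum_distrib_left using True
      by (intro sum.cong) (auto simp: assms(2))
    ultimately show ?thesis using outflow by simp
  next
    case False
    then have "A p q = 0" if "q \<in> W" for q using cut assms(4) that by auto
    moreover have "A' p q = 0" if "q \<in> W'" for q using cut' False assms(4) that by auto
    moreover have "v \<notin> W" "v \<notin> W'" using v disjoint by auto
    ultimately show ?thesis using finite agree[of p v] False assms(1,4) v by simp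
  qed
  then show ?thesis unfolding sum_split f.sum_split rest by simp
qed

text \<open>Since \<open>I\<close> lies in \<open>R\<close>, all rows of the branch are available to
  make \<open>x\<close> a multiple of \<open>z\<close> there. Rows in \<open>R\<close> keep their
  sums, rows in \<open>W'\<close> vanish on multiples of \<open>z'\<close>, and the multiple is
  recovered by \<open>branch_coeff\<close>, so exchanging back is the inverse.\<close>

lemma exchange_null_space:
  assumes "x \<in> null_space (R \<union> W - I) A" and "I \<subseteq> R"
  shows "exchange R W W' v z z' x \<in> null_space (R \<union> W' - I) A'"
    and "exchange R W' W v z' z (exchange R W W' v z z' x) = x"
proof -
  interpret f: branch_exchange R W' W v A' A z' z by (rule flip)
  define c where "c = branch_coeff W v z x"
  define x' where "x' = exchange R W W' v z z' x"
  have fin: "finite (R \<union> W)" "finite (R \<union> W')" using finite by auto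
  have zero: "\<And>p. p \<notin> R \<union> W - I \<Longrightarrow> x p = 0"
    and rows: "\<And>p. p \<in> R \<union> W - I \<Longrightarrow> (\<Sum>q\<in>R \<union> W. A p q * x q) = 0"
    using assms(1) unfolding null_space_Diff[OF fin(1)] by auto
  have x: "x q = c * z q" if "q \<in> insert v W" for q
    unfolding c_def by (rule coeff) (use rows that assms(2) disjoint in auto)
  have x'R: "x' q = x q" if "q \<in> R" for q using that by (simp add: x'_def exchange_def)
  have x': "x' q = c * z' q" if "q \<in> insert v W'" for q
    using that x[of v] z_v v disjoint by (auto simp: x'_def exchange_def c_def)
  show "x' \<in> null_space (R \<union> W' - I) A'"
    unfolding null_space_Diff[OF fin(2)]
  proof (intro conjI allI ballI impI)
    fix p assume "p \<notin> R \<union> W' - I"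
    then show "x' p = 0" using zero[of p] assms(2) by (auto simp: x'_def exchange_def)
  next
    fix p assume p: "p \<in> R \<union> W' - I"
    show "(\<Sum>q\<in>R \<union> W'. A' p q * x' q) = 0"
    proof (cases "p \<in> R")
      case True
      then show ?thesis using row_outside_branch[of x' x c p] x x' x'R rows[of p] p by auto
    next
      case False
      then show ?thesis using f.row_in_branch_zero[of x' c p] x' p by auto
    qed
  qed
  have "branch_coeff W' v z' x' = c" by (rule branch_coeff_eqI[OF f.z_nonzero x'])
  then show "exchange R W' W v z' z x' = x"
    using x x'R zero by (auto simp: exchange_def[of R W' W] fun_eq_iff)
qed

lemma nullity_eq:
  assumes "I \<subseteq> R"
  shows "nullity (R \<union> W' - I) A' = nullity (R \<union> W - I) A"
proof -
  interpret f: branch_exchange R W' W v A' A z' z by (rule flip)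
  let ?T = "exchange R W W' v z z'" and ?N = "null_space (R \<union> W - I) A"
  have inj: "inj_on ?T ?N"
    by (rule inj_on_inverseI) (rule exchange_null_space(2)[OF _ assms])
  have "?T ` ?N = null_space (R \<union> W' - I) A'"
  proof
    show "?T ` ?N \<subseteq> null_space (R \<union> W' - I) A'"
      using exchange_null_space(1)[OF _ assms] by blast
    show "null_space (R \<union> W' - I) A' \<subseteq> ?T ` ?N"
      using f.exchange_null_space[OF _ assms] by (metis image_eqI subsetI)
  qed
  moreover have "fun_space.dim (?T ` ?N) = fun_space.dim ?N"
    by (rule dim_inj_image[OF exchange_linear null_space_subspace inj])
  ultimately show ?thesis by (simp add: nullity_def)
qed

text \<open>As \<open>i\<close> lies in \<open>R\<close>, every column of \<open>X\<close> is a
  branch solution, hence a multiple \<open>c q\<close> of \<open>z\<close>. Replacing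
  \<open>z\<close> by \<open>z'\<close> turns \<open>X\<close> into a test matrix \<open>X'\<close>
  for \<open>A'\<close>, and \<open>X' = 0\<close> forces \<open>X = 0\<close>.\<close>

lemma SNIP_exchange:
  assumes snip: "SNIP (R \<union> W') i A'" and i: "i \<in> R"
  shows "SNIP (R \<union> W) i A"
  unfolding SNIP_def
proof (intro allI impI, elim conjE)
  interpret f: branch_exchange R W' W v A' A z' z by (rule flip)
  fix X
  assume sym: "symmetric_on (R \<union> W) X"
    and AX0: "\<forall>p\<in>R \<union> W. \<forall>q\<in>R \<union> W. A p q * X p q = 0"
    and diag: "\<forall>p\<in>R \<union> W. X p p = 0"
    and rows: "\<forall>p\<in>R \<union> W - {i}. \<forall>q\<in>R \<union> W. (\<Sum>r\<in>R \<union> W. A p r * X r q) = 0"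
  define c where "c q = branch_coeff W v z (\<lambda>p. X p q)" for q
  have X: "X p q = c q * z p" if "p \<in> insert v W" "q \<in> R \<union> W" for p q
    unfolding c_def using coeff[of "\<lambda>p. X p q" p] rows i that disjoint by fastforce
  have X_sym: "X p q = X q p" if "p \<in> R \<union> W" "q \<in> R \<union> W" for p q
    using sym that by (auto simp: symmetric_on_def)
  obtain q0 where q0: "q0 \<in> insert v W" "z q0 \<noteq> 0" using z_nonzero by blast
  have sub: "insert v W \<subseteq> R \<union> W" using v by auto
  have c_q0: "c q0 = 0" using X[of q0 q0] diag q0 sub by auto
  \<comment> \<open>On the branch \<open>X\<close> is a multiple of \<open>z z\<^sup>T\<close>, and its diagonal vanishes.\<close>
  have c0: "c q = 0" if "q \<in> insert v W" for q
    using X[of q0 q] X[of q q0] X_sym[of q q0] q0 c_q0 that sub by auto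
  \<comment> \<open>By symmetry and \<open>c0\<close>, \<open>X\<close> is \<open>c p * z q\<close>
    for \<open>p\<close> in \<open>R\<close> and \<open>q\<close> in \<open>W\<close>, and zero on
    the block of \<open>W\<close>; \<open>X'\<close> has the same form with \<open>z'\<close>. The
    pattern condition survives at \<open>v\<close> because \<open>c v = 0\<close>.\<close>
  define X' where "X' p q =
    (if p \<in> R then if q \<in> R then X p q else c p * z' q
     else if q \<in> R then c q * z' p else 0)" for p q
  have sym': "symmetric_on (R \<union> W') X'"
    using X_sym by (auto simp: symmetric_on_def X'_def)
  have pattern': "A' p q * X' p q = 0" if pq: "p \<in> R \<union> W'" "q \<in> R \<union> W'" for p q
  proof -
    consider "p \<in> R" "q \<in> R" | "p \<in> R" "q \<in> W'" "q \<notin> R" | "p \<in> W'" "p \<notin> R" "q \<in> R"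
      | "p \<notin> R" "q \<notin> R"
      using pq by blast
    then show ?thesis
    proof cases
      case 1
      then have "A p q * X p q = 0" "X p p = 0" using AX0 diag by auto
      then show ?thesis
        using 1 agree[of p q] by (cases "(p, q) = (v, v)") (auto simp: X'_def)
    next
      case 2
      then show ?thesis using cut'[of q p] c0[of v] by (cases "p = v") (auto simp: X'_def)
    next
      case 3
      then show ?thesis using cut'[of p q] c0[of v] by (cases "q = v") (auto simp: X'_def)
    qed (simp add: X'_def)
  qed
  have diag': "X' p p = 0" if "p \<in> R \<union> W'" for p
    using diag by (auto simp: X'_def)
  have rows': "(\<Sum>r\<in>R \<union> W'. A' p r * X' r q) = 0"
    if p: "p \<in> R \<union> W' - {i}" and q: "q \<in> R \<union> W'" for p q
  proof -
    \<comment> \<open>On \<open>R\<close>, column \<open>q\<close> of \<open>X'\<close> is a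
      multiple of a column of \<open>X\<close>: column \<open>q\<close> itself if \<open>q\<close>
      is in \<open>R\<close>, otherwise column \<open>q0\<close> scaled by
      \<open>z' q / z q0\<close>. The latter vanishes on \<open>insert v W\<close> because
      \<open>c q0 = 0\<close>, so \<open>d = 0\<close> then.\<close>
    define d where "d = (if q \<in> R then c q else 0)"
    define x where "x r = (if q \<in> R then X r q else z' q / z q0 * X r q0)" for r
    have "x r = d * z r" if "r \<in> insert v W" for r
      using that X[of r q] X[of r q0] q0 c_q0 sub by (auto simp: x_def d_def)
    moreover have "X' r q = x r" if "r \<in> R" for r
      using that X[of q0 r] X_sym[of r q0] q0 sub by (auto simp: X'_def x_def)
    moreover have "X' r q = d * z' r" if "r \<in> insert v W'" for r
      using that X[of v q] z_v c0[of v] v disjoint by (auto simp: X'_def d_def)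
    moreover have "(\<Sum>r\<in>R \<union> W. A p r * x r) = 0" if "p \<in> R"
    proof -
      have "(\<Sum>r\<in>R \<union> W. A p r * x r) =
        (if q \<in> R then 1 else z' q / z q0) *
          (\<Sum>r\<in>R \<union> W. A p r * X r (if q \<in> R then q else q0))"
        unfolding sum_distrib_left by (intro sum.cong) (auto simp: x_def)
      also have "(\<Sum>r\<in>R \<union> W. A p r * X r (if q \<in> R then q else q0)) = 0"
        using rows p that q0 sub by auto
      finally show ?thesis by simp
    qed
    ultimately show ?thesis
      using row_outside_branch[of "\<lambda>r. X' r q" x d p] f.row_in_branch_zero[of "\<lambda>r. X' r q" d p]
        p by (cases "p \<in> R") auto
  qed
  have X'0: "X' p q = 0" if "p \<in> R \<union> W'" "q \<in> R \<union> W'" for p q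
    by (rule SNIP_D[OF snip sym' _ _ _ that]) (fact pattern' diag' rows')+
  have XR: "X p q = 0" if "p \<in> R" "q \<in> R" for p q
    using X'0[of p q] that by (auto simp: X'_def)
  \<comment> \<open>An index where \<open>z'\<close> is nonzero recovers \<open>c q\<close> from
    \<open>X' = 0\<close>; if it is \<open>v\<close>, then \<open>z v\<close> is nonzero and
    \<open>X v q = 0\<close> gives the same.\<close>
  obtain q1 where q1: "q1 \<in> insert v W'" "z' q1 \<noteq> 0" using f.z_nonzero by blast
  have cR: "c q = 0" if "q \<in> R" for q
  proof (cases "q1 = v")
    case True
    then show ?thesis using X[of v q] XR[of v q] that v q1 z_v by auto
  next
    case False
    then have "X' q1 q = 0" "q1 \<notin> R" using X'0[of q1 q] q1 that disjoint by auto
    then show ?thesis using q1 that by (simp add: X'_def)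
  qed
  show "\<forall>p\<in>R \<union> W. \<forall>q\<in>R \<union> W. X p q = 0"
  proof (intro ballI)
    fix p q assume pq: "p \<in> R \<union> W" "q \<in> R \<union> W"
    then show "X p q = 0"
      using XR[of p q] X[of p q] X[of q p] X_sym[of p q] cR c0
      by (metis Un_iff insertI2 mult_zero_left)
  qed
qed

end

section \<open>Linear systems on a branch, and branches with prescribed value and outflow\<close>

lemma underdetermined_system:
  fixes A :: "'b \<Rightarrow> 'a \<Rightarrow> real"
  assumes "finite W" and "finite U" and "card W < card U"
  shows "\<exists>y. (\<exists>q\<in>U. y q \<noteq> 0) \<and> (\<forall>p\<in>W. (\<Sum>q\<in>U. A p q * y q) = 0)"
  using assms
proof (induction W arbitrary: U A rule: finite_induct)
  case empty
  then have "U \<noteq> {}" by auto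
  then show ?case by (intro exI[of _ "\<lambda>_. 1"]) auto
next
  case (insert p W)
  show ?case
  proof (cases "\<forall>q\<in>U. A p q = 0")
    case True
    obtain y where "\<exists>q\<in>U. y q \<noteq> 0" "\<forall>p\<in>W. (\<Sum>q\<in>U. A p q * y q) = 0"
      using insert.IH[of U A] insert.prems insert.hyps by auto
    then show ?thesis using True by (intro exI[of _ y]) auto
  next
    case False
    then obtain q0 where q0: "q0 \<in> U" "A p q0 \<noteq> 0" by blast
    define U' where "U' = U - {q0}"
    have U': "finite U'" "q0 \<notin> U'" "U = insert q0 U'" "card W < card U'"
      using insert q0 by (auto simp: U'_def)
    \<comment> \<open>Gaussian elimination: the pivot row \<open>p\<close> removes the unknown
      \<open>q0\<close>, and \<open>a\<close> below is the back substitution.\<close>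
    obtain y where y: "\<exists>q\<in>U'. y q \<noteq> 0"
      and rows: "\<And>r. r \<in> W \<Longrightarrow> (\<Sum>q\<in>U'. (A r q - A r q0 * A p q / A p q0) * y q) = 0"
      using insert.IH[OF U'(1,4), of "\<lambda>r q. A r q - A r q0 * A p q / A p q0"] by blast
    define a where "a = - (\<Sum>q\<in>U'. A p q * y q) / A p q0"
    have expand: "(\<Sum>q\<in>U. A r q * (y(q0 := a)) q) = A r q0 * a + (\<Sum>q\<in>U'. A r q * y q)" for r
    proof -
      have "(\<Sum>q\<in>U'. A r q * (y(q0 := a)) q) = (\<Sum>q\<in>U'. A r q * y q)"
        using U'(2) by (intro sum.cong) auto
      then show ?thesis using U' by simp
    qed
    have "(\<Sum>q\<in>U. A r q * (y(q0 := a)) q) = 0" if "r \<in> insert p W" for r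
    proof (cases "r = p")
      case True
      then show ?thesis unfolding expand using q0 by (simp add: a_def)
    next
      case False
      have "(\<Sum>q\<in>U'. (A r q - A r q0 * A p q / A p q0) * y q) =
        (\<Sum>q\<in>U'. A r q * y q) - A r q0 / A p q0 * (\<Sum>q\<in>U'. A p q * y q)"
        by (simp add: sum_distrib_left algebra_simps sum_subtractf)
      then show ?thesis unfolding expand using rows[of r] that False by (simp add: a_def)
    qed
    moreover have "\<exists>q\<in>U. (y(q0 := a)) q \<noteq> 0" using y U' by auto
    ultimately show ?thesis by blast
  qed
qed

definition branch_nondegenerate :: "'a set \<Rightarrow> 'a \<Rightarrow> ('a \<Rightarrow> 'a \<Rightarrow> real) \<Rightarrow> bool" where
  "branch_nondegenerate W v A \<longleftrightarrow>
     (\<forall>y. branch_solution W v A y \<and> y v = 0 \<and> outflow W v A y = 0 \<longrightarrow> (\<forall>q\<in>W. y q = 0))"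

text \<open>Green's identity: in the bilinear form of \<open>A\<close> on \<open>insert v W\<close>,
  rows in \<open>W\<close> contribute nothing against a solution, so the form is the value of one
  vector at \<open>v\<close> times the outflow of the other; symmetry of \<open>A\<close> swaps the
  two.\<close>

lemma outflow_symmetric:
  assumes "finite W" and "v \<notin> W" and "symmetric_on (insert v W) A"
    and "branch_solution W v A x" and "branch_solution W v A y"
  shows "x v * outflow W v A y = y v * outflow W v A x"
proof -
  have pair: "(\<Sum>p\<in>insert v W. \<Sum>q\<in>insert v W. A p q * a p * b q) = a v * outflow W v A b"
    if "branch_solution W v A b" for a b
  proof -
    have "(\<Sum>p\<in>insert v W. \<Sum>q\<in>insert v W. A p q * a p * b q) =
      (\<Sum>p\<in>insert v W. a p * (\<Sum>q\<in>insert v W. A p q * b q))"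
      by (simp only: sum_distrib_left mult_ac)
    also have "\<dots> = a v * (\<Sum>q\<in>insert v W. A v q * b q) +
        (\<Sum>p\<in>W. a p * (\<Sum>q\<in>insert v W. A p q * b q))"
      by (rule sum.insert) (use assms in auto)
    also have "(\<Sum>p\<in>W. a p * (\<Sum>q\<in>insert v W. A p q * b q)) = 0"
      by (rule sum.neutral) (use that in \<open>simp add: branch_solution_def\<close>)
    finally show ?thesis by (simp only: outflow_def add_0_right)
  qed
  have "x v * outflow W v A y = (\<Sum>p\<in>insert v W. \<Sum>q\<in>insert v W. A p q * x p * y q)"
    using pair[OF assms(5)] by simp
  also have "\<dots> = (\<Sum>q\<in>insert v W. \<Sum>p\<in>insert v W. A p q * x p * y q)"
    by (rule sum.swap)
  also have "\<dots> = (\<Sum>q\<in>insert v W. \<Sum>p\<in>insert v W. A q p * y q * x p)"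
    using assms(3) by (intro sum.cong) (auto simp: symmetric_on_def)
  also have "\<dots> = y v * outflow W v A x" by (rule pair[OF assms(4)])
  finally show ?thesis .
qed

text \<open>By \<open>outflow_symmetric\<close> the pairs (value at \<open>v\<close>, outflow) of
  two solutions are proportional. Subtracting a suitable multiple of \<open>z\<close> leaves a
  solution with both zero, which vanishes by nondegeneracy.\<close>

lemma branch_generatorI:
  assumes "finite W" and "v \<notin> W" and "symmetric_on (insert v W) A"
    and nondeg: "branch_nondegenerate W v A"
    and z: "branch_solution W v A z" and nonzero: "\<exists>q\<in>insert v W. z q \<noteq> 0"
  shows "branch_generator W v A z" and "z v \<noteq> 0 \<or> outflow W v A z \<noteq> 0"
proof -
  show nz: "z v \<noteq> 0 \<or> outflow W v A z \<noteq> 0"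
    using nondeg z nonzero unfolding branch_nondegenerate_def by (metis insert_iff)
  have "\<exists>c. \<forall>q\<in>insert v W. y q = c * z q" if y: "branch_solution W v A y" for y
  proof -
    \<comment> \<open>\<open>c\<close> is read off from a nonzero coordinate of the pair of
      \<open>z\<close>; \<open>green\<close> settles the other coordinate.\<close>
    define c where "c = (if z v \<noteq> 0 then y v / z v else outflow W v A y / outflow W v A z)"
    have green: "z v * outflow W v A y = y v * outflow W v A z"
      using outflow_symmetric[OF assms(1-3) z y] .
    have row: "(\<Sum>q\<in>insert v W. A p q * (y q - c * z q)) =
        (\<Sum>q\<in>insert v W. A p q * y q) - c * (\<Sum>q\<in>insert v W. A p q * z q)" for p
      by (simp only: right_diff_distrib sum_subtractf sum_distrib_left mult.left_commute)
    have "branch_solution W v A (\<lambda>q. y q - c * z q)"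
      using y z unfolding branch_solution_def row by simp
    moreover have v0: "y v - c * z v = 0"
      using green nz by (cases "z v = 0") (auto simp: c_def)
    moreover have "outflow W v A (\<lambda>q. y q - c * z q) = 0"
      using green nz unfolding outflow_def row unfolding outflow_def[symmetric]
      by (cases "z v = 0") (auto simp: c_def field_simps)
    ultimately have "\<forall>q\<in>W. y q - c * z q = 0"
      using nondeg unfolding branch_nondegenerate_def by blast
    with v0 show ?thesis by (intro exI[of _ c]) auto
  qed
  then show "branch_generator W v A z" using z nonzero by (simp add: branch_generator_def)
qed

text \<open>There is one row fewer in \<open>W\<close> than there are unknowns on
  \<open>insert v W\<close>, so a nonzero solution exists.\<close>

lemma branch_generator_exists:
  assumes "finite W" and "v \<notin> W" and "symmetric_on (insert v W) A"
    and "branch_nondegenerate W v A"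
  obtains z where "branch_generator W v A z" and "z v \<noteq> 0 \<or> outflow W v A z \<noteq> 0"
proof -
  obtain z where "\<exists>q\<in>insert v W. z q \<noteq> 0" "branch_solution W v A z"
    using underdetermined_system[of W "insert v W" A] assms(1,2)
    unfolding branch_solution_def by auto
  then show ?thesis using that branch_generatorI[OF assms] by blast
qed

text \<open>For \<open>t \<noteq> 0\<close> the rows in \<open>W\<close> are made diagonally
  dominant, so a solution is determined by its value at \<open>v\<close>; the diagonal entry
  \<open>d\<close> at \<open>v\<close>, which occurs in no row of \<open>W\<close>, then adjusts the
  outflow. For \<open>t = 0\<close> this dominance would force \<open>z = 0\<close> on the branch,
  so row \<open>u\<close> is treated separately.\<close>

lemma branch_realization:
  assumes "pair_graph H" and "v \<in> pverts H" and uv: "(v, u) \<in> parcs H"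
    and ts: "t \<noteq> 0 \<or> s \<noteq> 0"
  shows "\<exists>M z. M \<in> graph_matrices H \<and> branch_generator (pverts H - {v}) v M z \<and>
    z v = t \<and> outflow (pverts H - {v}) v M z = s"
proof -
  interpret pair_graph H by (rule assms)
  define W where "W = pverts H - {v}"
  have W: "finite W" "v \<notin> W"
    using pair_finite_verts by (auto simp: W_def)
  have "u \<noteq> v" using uv pair_no_loops by fastforce
  then have u: "u \<in> W" using uv in_arcsD2 by (auto simp: W_def)
  have arcs_sym: "(q, p) \<in> parcs H" if "(p, q) \<in> parcs H" for p q
    using that pair_sym_arcs by (auto simp: symmetric_def dest: symD)
  \<comment> \<open>Within \<open>W\<close>, a row has at most \<open>card W\<close> off-diagonal
    entries, each 0 or 1, so \<open>K\<close> dominates them; the weight \<open>b\<close> only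
    occurs in row or column \<open>v\<close>.\<close>
  define K where "K = real (card W) + 1"
  define M where "M d e b p q =
    (if p = q then if p = v then d else if p = u then e else K
     else if (p, q) = (u, v) \<or> (p, q) = (v, u) then b
     else if (p, q) \<in> parcs H then 1 else 0)" for d e b p q
  have pattern: "M d e b \<in> graph_matrices H" if "b \<noteq> 0" for d e b
    using that uv arcs_sym by (auto simp: graph_matrices_def symmetric_on_def M_def)
  have M_sym: "symmetric_on (insert v W) (M d e b)" for d e b
    using arcs_sym by (auto simp: symmetric_on_def M_def)
  have dominant: "(\<Sum>q\<in>S - {p}. \<bar>M d e b p q\<bar>) < \<bar>M d e b p p\<bar>"
    if "S \<subseteq> W" "p \<in> S" "p = u \<Longrightarrow> e = K" for S p d e b
  proof -
    have "(\<Sum>q\<in>S - {p}. \<bar>M d e b p q\<bar>) \<le> (\<Sum>q\<in>S - {p}. 1)"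
      using that W by (intro sum_mono) (auto simp: M_def)
    also have "\<dots> \<le> real (card W)"
      using card_mono[OF W(1), of "S - {p}"] that by auto
    also have "\<dots> < \<bar>M d e b p p\<bar>" using that W by (auto simp: M_def K_def)
    finally show ?thesis .
  qed
  show ?thesis
  proof (cases "t = 0")
    case False
    have nondeg: "\<forall>q\<in>W. y q = 0" if "branch_solution W v (M d K 1) y" "y v = 0" for d y
    proof
      fix q assume "q \<in> W"
      then show "y q = 0"
        using that W dominant[of W]
        by (intro diag_dominant_null[of W "M d K 1" y]) (auto simp: branch_solution_def)
    qed
    obtain y where y: "\<exists>q\<in>insert v W. y q \<noteq> 0" and sol: "branch_solution W v (M 0 K 1) y"
      using underdetermined_system[of W "insert v W" "M 0 K 1"] W(1,2)
      unfolding branch_solution_def by auto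
    have yv: "y v \<noteq> 0" using nondeg[OF sol] y by auto
    define z where "z q = t / y v * y q" for q
    define d where "d = (s - (\<Sum>q\<in>W. M 0 K 1 v q * z q)) / t"
    have "(\<Sum>q\<in>insert v W. M d K 1 p q * z q) = t / y v * (\<Sum>q\<in>insert v W. M 0 K 1 p q * y q)"
      if "p \<in> W" for p
      unfolding sum_distrib_left using that W(2) by (intro sum.cong) (auto simp: M_def z_def)
    then have z: "branch_solution W v (M d K 1) z"
      using sol by (simp add: branch_solution_def)
    have zv: "z v = t" using yv by (simp add: z_def)
    have "(\<Sum>q\<in>W. M d K 1 v q * z q) = (\<Sum>q\<in>W. M 0 K 1 v q * z q)"
      using W(2) by (intro sum.cong) (auto simp: M_def)
    then have "outflow W v (M d K 1) z = s"
      using W(1,2) False zv by (simp add: outflow_def d_def M_def[of _ _ _ v v])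
    moreover have "branch_generator W v (M d K 1) z"
      using nondeg zv False
      by (intro branch_generatorI(1)[OF W(1,2) M_sym _ z]) (auto simp: branch_nondegenerate_def)
    ultimately show ?thesis using zv pattern[of 1 d K] unfolding W_def by force
  next
    case True
    \<comment> \<open>Solve all rows but \<open>u\<close>; row \<open>u\<close> is then fixed by its diagonal entry \<open>e\<close>, and the weight \<open>b\<close> of
      the edge \<open>{u, v}\<close>, which does not enter these rows because \<open>z v = 0\<close>, makes the outflow nonzero.\<close>
    define S where "S = W - {u}"
    have S: "finite S" "u \<notin> S" "v \<notin> S" "W = insert u S"
      using W(1,2) u by (auto simp: S_def)
    have card_S: "card S < card W" unfolding S_def by (rule card_Diff1_less[OF W(1) u])
    obtain y where y: "\<exists>q\<in>W. y q \<noteq> 0"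
      and rows: "\<And>p. p \<in> S \<Longrightarrow> (\<Sum>q\<in>W. M 0 0 1 p q * y q) = 0"
      using underdetermined_system[of S W "M 0 0 1"] S(1) card_S W(1) by blast
    \<comment> \<open>These rows contain none of \<open>d\<close>, \<open>e\<close>,
      \<open>b\<close> in the columns of \<open>W\<close>, so the parameters may be chosen after
      \<open>y\<close>.\<close>
    have M_S: "M d e b p q = M 0 0 1 p q" if "p \<in> S" "q \<in> W" for d e b p q
      using that S W(2) by (auto simp: M_def)
    have zero: "x q = 0"
      if x: "\<And>p. p \<in> S \<Longrightarrow> (\<Sum>q\<in>W. M 0 0 1 p q * x q) = 0" "x u = 0" and q: "q \<in> W"
      for x q
    proof (cases "q = u")
      case False
      show ?thesis
      proof (rule diag_dominant_null[of S "M 0 0 1" x])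
        show "(\<Sum>q\<in>S. M 0 0 1 p q * x q) = 0" if "p \<in> S" for p
          using x(1)[OF that] x(2) S by simp
      qed (use S False q dominant[of S] in auto)
    qed (use x in simp)
    have yu: "y u \<noteq> 0" using zero[OF rows] y by blast
    define a where "a = (\<Sum>q\<in>S. M 0 0 1 v q * y q)"
    \<comment> \<open>As \<open>y u \<noteq> 0\<close>, the numbers \<open>y u + a\<close> and
      \<open>2 * y u + a\<close> are not both zero.\<close>
    obtain b where b: "b \<noteq> 0" "b * y u + a \<noteq> 0"
    proof (cases "y u + a = 0")
      case True
      then show ?thesis using that[of 2] yu by auto
    qed (use that[of 1] in auto)
    \<comment> \<open>\<open>e\<close> is solved from row \<open>u\<close>; \<open>k\<close> scales
      the outflow to \<open>s\<close>.\<close>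
    define e where "e = - (\<Sum>q\<in>S. M 0 0 1 u q * y q) / y u"
    define k where "k = s / (b * y u + a)"
    have k: "k \<noteq> 0" using b ts True by (simp add: k_def)
    define z where "z q = (if q = v then 0 else k * y q)" for q
    have flow: "outflow W v (M 0 e b) x = c * (b * y u + a)"
      if "x v = 0" "\<And>q. q \<in> W \<Longrightarrow> x q = c * y q" for x c
    proof -
      have "(\<Sum>q\<in>S. M 0 e b v q * x q) = c * a"
        unfolding a_def sum_distrib_left using that S by (intro sum.cong) (auto simp: M_def)
      then show ?thesis
        using that S W(1,2) u \<open>u \<noteq> v\<close>
        by (simp add: outflow_def M_def[of _ _ _ v u] algebra_simps)
    qed
    have branch_row: "(\<Sum>q\<in>insert v W. M 0 e b p q * x q) = (\<Sum>q\<in>W. M 0 e b p q * x q)"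
      if "x v = 0" for p x
      using that W by simp
    have "(\<Sum>q\<in>W. M 0 e b p q * z q) = 0" if "p \<in> W" for p
    proof -
      have "(\<Sum>q\<in>W. M 0 e b p q * z q) = k * (\<Sum>q\<in>W. M 0 e b p q * y q)"
        unfolding sum_distrib_left using W(2) by (intro sum.cong) (auto simp: z_def)
      also have "(\<Sum>q\<in>W. M 0 e b p q * y q) = 0"
      proof (cases "p = u")
        case True
        have "(\<Sum>q\<in>S. M 0 e b u q * y q) = (\<Sum>q\<in>S. M 0 0 1 u q * y q)"
          using S \<open>u \<noteq> v\<close> by (intro sum.cong) (auto simp: M_def)
        then show ?thesis
          using True S yu \<open>u \<noteq> v\<close> by (simp add: e_def M_def[of _ _ _ u u])
      next
        case False
        then have "p \<in> S" using that S by auto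
        then show ?thesis using rows[of p] M_S[of p _ 0 e b] by simp
      qed
      finally show ?thesis by simp
    qed
    then have z: "branch_solution W v (M 0 e b) z"
      using branch_row[of z] by (simp add: branch_solution_def z_def)
    have "branch_nondegenerate W v (M 0 e b)"
      unfolding branch_nondegenerate_def
    proof (intro allI impI, elim conjE)
      fix x assume x: "branch_solution W v (M 0 e b) x" "x v = 0" "outflow W v (M 0 e b) x = 0"
      \<comment> \<open>With this \<open>c\<close>, the vector \<open>x - c y\<close> solves the
        rows in \<open>S\<close> and vanishes at \<open>u\<close>, hence on \<open>W\<close>. The
        outflow of \<open>x\<close> is then \<open>c * (b * y u + a)\<close>, which is zero only for
        \<open>c = 0\<close>.\<close>
      define c where "c = x u / y u"
      have "x q - c * y q = 0" if "q \<in> W" for q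
      proof (rule zero[OF _ _ that])
        fix p assume p: "p \<in> S"
        have "(\<Sum>q\<in>W. M 0 0 1 p q * x q) = (\<Sum>q\<in>insert v W. M 0 e b p q * x q)"
          using M_S[OF p, of _ 0 e b] x(2) branch_row by simp
        also have "\<dots> = 0" using x(1) p S by (simp add: branch_solution_def)
        finally show "(\<Sum>q\<in>W. M 0 0 1 p q * (x q - c * y q)) = 0"
          using rows[OF p]
          by (simp add: right_diff_distrib sum_subtractf mult.left_commute flip: sum_distrib_left)
      qed (use yu in \<open>simp add: c_def\<close>)
      then have xc: "\<And>q. q \<in> W \<Longrightarrow> x q = c * y q" by simp
      have "c = 0" using flow[OF x(2) xc] x(3) b by simp
      then show "\<forall>q\<in>W. x q = 0" using xc by simp
    qed
    moreover have "\<exists>q\<in>insert v W. z q \<noteq> 0" using u yu k \<open>u \<noteq> v\<close> by (auto simp: z_def)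
    ultimately have "branch_generator W v (M 0 e b) z"
      by (intro branch_generatorI(1)[OF W(1,2) M_sym _ z])
    moreover have "z q = k * y q" if "q \<in> W" for q using that W(2) by (auto simp: z_def)
    then have "outflow W v (M 0 e b) z = s"
      using flow[of z k] b by (simp add: z_def k_def)
    ultimately show ?thesis using True pattern[OF b(1), of 0 e] unfolding W_def z_def by force
  qed
qed

section \<open>Exchanging a summand of a vertex sum\<close>

lemma branch_generator_cong:
  assumes "\<And>p q. p \<in> insert v W \<Longrightarrow> q \<in> insert v W \<Longrightarrow> A p q = B p q"
  shows "branch_generator W v A z \<longleftrightarrow> branch_generator W v B z"
    and "outflow W v A z = outflow W v B z"
proof -
  have row: "(\<Sum>q\<in>insert v W. A p q * y q) = (\<Sum>q\<in>insert v W. B p q * y q)"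
    if "p \<in> insert v W" for p y
    using assms that by (intro sum.cong) auto
  then have "branch_solution W v A y = branch_solution W v B y" for y
    unfolding branch_solution_def by (metis insertI2)
  then show "branch_generator W v A z \<longleftrightarrow> branch_generator W v B z"
    by (simp only: branch_generator_def)
  show "outflow W v A z = outflow W v B z"
    unfolding outflow_def by (rule row) simp
qed

lemma pair_graph_union:
  assumes "pair_graph H" and "pair_graph H'"
  shows "pair_graph \<lparr>pverts = pverts H \<union> pverts H', parcs = parcs H \<union> parcs H'\<rparr>"
proof -
  interpret H: pair_graph H by (rule assms)
  interpret H': pair_graph H' by (rule assms)
  have "sym (parcs H \<union> parcs H')"
    using H.pair_sym_arcs H'.pair_sym_arcs by (auto simp: symmetric_def intro: sym_Un)
  moreover have "fst e \<in> pverts H \<union> pverts H' \<and> snd e \<in> pverts H \<union> pverts H' \<and> fst e \<noteq> snd e"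
    if "e \<in> parcs H \<union> parcs H'" for e
    using that H.arc_fst_in_verts H.arc_snd_in_verts H.pair_no_loops
      H'.arc_fst_in_verts H'.arc_snd_in_verts H'.pair_no_loops by blast
  ultimately show ?thesis
    by unfold_locales
      (simp_all add: symmetric_def H.pair_finite_verts H.pair_finite_arcs
        H'.pair_finite_verts H'.pair_finite_arcs)
qed

lemma vertex_sum_exchange:
  assumes H: "pair_graph H" and H1: "pair_graph H\<^sub>1" and H2: "pair_graph H\<^sub>2"
    and G: "is_vertex_sum H\<^sub>1 v H G" and G': "is_vertex_sum H\<^sub>2 v H G'"
    and vu: "(v, u) \<in> parcs H\<^sub>2" and i: "i \<in> pverts H"
    and A: "A \<in> graph_matrices G" and snip: "SNIP (pverts G) i A"
    and nondeg: "branch_nondegenerate (pverts H\<^sub>1 - {v}) v A"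
  shows "\<exists>A'\<in>graph_matrices G'.
    SNIP (pverts G') i A' \<and> nullity_pair (pverts G') i A' = nullity_pair (pverts G) i A"
proof -
  interpret H: pair_graph H by (rule H)
  interpret H1: pair_graph "H\<^sub>1" by (rule H1)
  interpret H2: pair_graph "H\<^sub>2" by (rule H2)
  define R W W' where "R = pverts H" and "W = pverts H\<^sub>1 - {v}" and "W' = pverts H\<^sub>2 - {v}"
  have int: "pverts H\<^sub>1 \<inter> R = {v}" "pverts H\<^sub>2 \<inter> R = {v}"
    and verts: "pverts G = R \<union> W" "pverts G' = R \<union> W'"
    and arcs: "parcs G = parcs H\<^sub>1 \<union> parcs H" "parcs G' = parcs H\<^sub>2 \<union> parcs H"
    using G G' by (auto simp: is_vertex_sum_def R_def W_def W'_def)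
  have v: "v \<in> R" "v \<notin> W" "v \<notin> W'" and H_verts: "pverts H\<^sub>1 = insert v W" "pverts H\<^sub>2 = insert v W'"
    and disjoint: "R \<inter> W = {}" "R \<inter> W' = {}"
    using int by (auto simp: W_def W'_def)
  have fin: "finite R" "finite W" "finite W'"
    using H.pair_finite_verts H1.pair_finite_verts H2.pair_finite_verts
    by (auto simp: R_def W_def W'_def)
  have A_sym: "symmetric_on (R \<union> W) A"
    and A_arc: "\<And>p q. p \<in> R \<union> W \<Longrightarrow> q \<in> R \<union> W \<Longrightarrow> p \<noteq> q \<Longrightarrow>
      A p q \<noteq> 0 \<longleftrightarrow> (p, q) \<in> parcs H\<^sub>1 \<union> parcs H"
    using A by (auto simp: graph_matrices_def verts arcs)
  have arcH: "p \<in> R \<and> q \<in> R \<and> p \<noteq> q" if "(p, q) \<in> parcs H" for p q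
    using that H.in_arcsD1 H.in_arcsD2 H.pair_no_loops[of "(p, q)"] by (auto simp: R_def)
  have arcH1: "p \<in> insert v W \<and> q \<in> insert v W \<and> p \<noteq> q" if "(p, q) \<in> parcs H\<^sub>1" for p q
    using that H1.in_arcsD1 H1.in_arcsD2 H1.pair_no_loops[of "(p, q)"] H_verts by auto
  have arcH2: "p \<in> insert v W' \<and> q \<in> insert v W' \<and> p \<noteq> q" if "(p, q) \<in> parcs H\<^sub>2" for p q
    using that H2.in_arcsD1 H2.in_arcsD2 H2.pair_no_loops[of "(p, q)"] H_verts by auto
  have "symmetric_on (insert v W) A" using A_sym v by (auto simp: symmetric_on_def)
  then obtain z where z: "branch_generator W v A z" "z v \<noteq> 0 \<or> outflow W v A z \<noteq> 0"
    using branch_generator_exists[OF fin(2) v(2) _ nondeg[folded W_def]] by blast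
  obtain M z' where M: "M \<in> graph_matrices H\<^sub>2" and z': "branch_generator W' v M z'"
      "z' v = z v" "outflow W' v M z' = outflow W v A z"
    using branch_realization[OF H2 _ vu z(2)] H_verts(2) unfolding W'_def by blast
  have M_sym: "symmetric_on (insert v W') M"
    and M_arc: "\<And>p q. p \<in> insert v W' \<Longrightarrow> q \<in> insert v W' \<Longrightarrow> p \<noteq> q \<Longrightarrow>
      M p q \<noteq> 0 \<longleftrightarrow> (p, q) \<in> parcs H\<^sub>2"
    using M by (auto simp: graph_matrices_def H_verts)
  \<comment> \<open>The entry at \<open>(v, v)\<close> is taken from \<open>M\<close> and not from
    \<open>A\<close>: the outflow of \<open>z\<close> already counts \<open>A v v\<close>, and
    \<open>M\<close> was chosen with the same outflow.\<close>
  define A' where "A' p q =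
    (if p \<in> insert v W' \<and> q \<in> insert v W' then M p q
     else if p \<in> R \<and> q \<in> R then A p q else 0)" for p q
  have A'_M: "A' p q = M p q" if "p \<in> insert v W'" "q \<in> insert v W'" for p q
    using that by (simp add: A'_def)
  have cut: "A p q = 0" "A q p = 0" if "p \<in> W" "q \<in> R - {v}" for p q
    using that A_arc[of p q] A_arc[of q p] arcH[of p q] arcH[of q p] arcH1[of p q] arcH1[of q p]
      disjoint by auto
  have branch: "branch_exchange R W W' v A A' z z'"
  proof
    show "branch_generator W' v A' z'"
      using z'(1) branch_generator_cong(1)[of v W' A' M] A'_M by simp
    show "outflow W v A z = outflow W' v A' z'"
      using z'(3) branch_generator_cong(2)[of v W' A' M] A'_M by simp
    show "A' p q = 0 \<and> A' q p = 0" if "p \<in> W'" "q \<in> R - {v}" for p q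
      using that disjoint by (auto simp: A'_def)
    show "A p q = A' p q" if "p \<in> R" "q \<in> R" "(p, q) \<noteq> (v, v)" for p q
      using that disjoint by (auto simp: A'_def)
  qed (use fin v(1) disjoint cut z z' in auto)
  interpret e: branch_exchange R W W' v A A' z z' by (rule branch)
  interpret f: branch_exchange R W' W v A' A z' z by (rule e.flip)
  have "A' p q = A' q p" if "p \<in> R \<union> W'" "q \<in> R \<union> W'" for p q
    using that M_sym A_sym v by (auto simp: A'_def symmetric_on_def)
  moreover have "A' p q \<noteq> 0 \<longleftrightarrow> (p, q) \<in> parcs H\<^sub>2 \<union> parcs H"
    if pq: "p \<in> R \<union> W'" "q \<in> R \<union> W'" "p \<noteq> q" for p q
  proof -
    consider "p \<in> insert v W'" "q \<in> insert v W'"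
      | "p \<in> R" "q \<in> R" "\<not> (p \<in> insert v W' \<and> q \<in> insert v W')"
      | "\<not> (p \<in> R \<and> q \<in> R)" "\<not> (p \<in> insert v W' \<and> q \<in> insert v W')"
      by blast
    then show ?thesis
    proof cases
      case 1
      then have "(p, q) \<notin> parcs H" using arcH[of p q] disjoint pq by auto
      then show ?thesis using 1 A'_M M_arc pq by auto
    next
      case 2
      then have "(p, q) \<notin> parcs H\<^sub>2" "(p, q) \<notin> parcs H\<^sub>1"
        using arcH2[of p q] arcH1[of p q] disjoint pq by auto
      moreover have "A' p q = A p q" using 2 by (auto simp: A'_def)
      ultimately show ?thesis using A_arc[of p q] 2 pq by simp
    next
      case 3
      then have "A' p q = 0" unfolding A'_def by (simp only: if_False)
      then show ?thesis using 3 arcH[of p q] arcH2[of p q] by blast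
    qed
  qed
  ultimately have "A' \<in> graph_matrices G'"
    unfolding graph_matrices_def symmetric_on_def verts arcs by blast
  moreover have "SNIP (pverts G') i A'"
    using f.SNIP_exchange snip i unfolding verts R_def by blast
  moreover have "nullity_pair (pverts G') i A' = nullity_pair (pverts G) i A"
    using e.nullity_eq[of "{}"] e.nullity_eq[of "{i}"] i
    unfolding nullity_pair_def verts by (simp add: R_def)
  ultimately show ?thesis by blast
qed

section \<open>Degenerate branches and the SNIP\<close>

lemma SNIP_no_independent_null_vectors:
  assumes snip: "SNIP V i A" and disjoint: "S \<inter> T = {}"
    and zero: "\<And>p q. p \<in> S \<Longrightarrow> q \<in> T \<Longrightarrow> A p q = 0 \<and> A q p = 0"
    and x: "x \<in> null_space V A" "\<And>p. p \<notin> S \<Longrightarrow> x p = 0"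
    and y: "y \<in> null_space V A" "\<And>p. p \<notin> T \<Longrightarrow> y p = 0"
  shows "x = 0 \<or> y = 0"
proof (rule ccontr)
  assume "\<not> ?thesis"
  then obtain p q where pq: "x p \<noteq> 0" "y q \<noteq> 0" by (auto simp: fun_eq_iff)
  \<comment> \<open>\<open>X\<close> is supported on pairs between \<open>S\<close> and
    \<open>T\<close>, where \<open>A\<close> vanishes and which avoid the diagonal; its columns are
    combinations of null vectors of \<open>A\<close>.\<close>
  define X where "X p q = x p * y q + y p * x q" for p q
  have "A p q * X p q = 0" for p q
    using x(2)[of p] x(2)[of q] y(2)[of p] y(2)[of q] zero[of p q] zero[of q p]
      disjoint
    by (cases "p \<in> S"; cases "q \<in> S"; cases "p \<in> T"; cases "q \<in> T") (auto simp: X_def)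
  moreover have "X p p = 0" for p
    using x(2)[of p] y(2)[of p] disjoint by (auto simp: X_def)
  moreover have "(\<Sum>r\<in>V. A p r * X r q) = 0" if "p \<in> V" for p q
  proof -
    have "(\<Sum>r\<in>V. A p r * X r q) =
      y q * (\<Sum>r\<in>V. A p r * x r) + x q * (\<Sum>r\<in>V. A p r * y r)"
      by (simp add: X_def algebra_simps sum.distrib sum_distrib_left)
    then show ?thesis using x(1) y(1) that by (simp add: null_space_def)
  qed
  moreover have "symmetric_on V X" by (simp add: symmetric_on_def X_def)
  moreover have "p \<in> V" "q \<in> V" using pq x(1) y(1) by (auto simp: null_space_def)
  ultimately have "X p q = 0"
    using SNIP_D[OF snip, of X p q] by simp
  moreover have "y p = 0" using pq x(2)[of p] y(2)[of p] disjoint by auto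
  ultimately show False using pq by (simp add: X_def)
qed

text \<open>The offending branch solution is extended by zero. Rows in \<open>W\<close> vanish
  because it is a solution, row \<open>v\<close> because its outflow is zero, and all other rows
  because they have no entries in the columns of \<open>W\<close>.\<close>

lemma degenerate_branch_null_vector:
  assumes fin: "finite V" and W: "insert v W \<subseteq> V" "v \<notin> W"
    and cut: "\<And>p q. p \<in> V - insert v W \<Longrightarrow> q \<in> W \<Longrightarrow> A p q = 0"
    and deg: "\<not> branch_nondegenerate W v A"
  obtains x where "x \<in> null_space V A" "\<And>p. p \<notin> W \<Longrightarrow> x p = 0" "x \<noteq> 0"
proof -
  obtain y q where y: "branch_solution W v A y" "y v = 0" "outflow W v A y = 0"
    and q: "q \<in> W" "y q \<noteq> 0"
    using deg by (auto simp: branch_nondegenerate_def)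
  define x where "x p = (if p \<in> W then y p else 0)" for p
  have "(\<Sum>q\<in>V. A p q * x q) = 0" if "p \<in> V" for p
  proof -
    have "(\<Sum>q\<in>V. A p q * x q) = (\<Sum>q\<in>insert v W. A p q * x q)"
      by (rule sum.mono_neutral_right) (use fin W in \<open>auto simp: x_def\<close>)
    also have "\<dots> = (\<Sum>q\<in>insert v W. A p q * y q)"
      using y(2) by (intro sum.cong) (auto simp: x_def)
    also have "\<dots> = 0"
    proof (cases "p \<in> insert v W")
      case True
      then show ?thesis using y unfolding branch_solution_def outflow_def by blast
    next
      case False
      then show ?thesis using cut[of p] that y(2) by (intro sum.neutral) auto
    qed
    finally show ?thesis .
  qed
  then have "x \<in> null_space V A" using W by (auto simp: null_space_def x_def)
  moreover have "x \<noteq> 0" using q by (auto simp: x_def fun_eq_iff)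
  ultimately show ?thesis using that by (simp add: x_def)
qed

section \<open>Double vertex sums and their attained nullity sums\<close>

lemma connected_obtains_neighbour:
  assumes "pair_graph H" and "Digraph_Component.connected (with_proj H)"
    and "card (pverts H) \<ge> 2" and v: "v \<in> pverts H"
  obtains u where "(v, u) \<in> parcs H"
proof -
  interpret pair_graph H by (rule assms)
  obtain w where w: "w \<in> pverts H" "w \<noteq> v"
    using assms(3) v pair_finite_verts
    by (metis card_le_Suc0_iff_eq not_less_eq_eq numeral_2_eq_2)
  \<comment> \<open>Connectedness is defined through the symmetric closure, which has the same
    reachability here; the first arc of a path to \<open>w\<close> gives \<open>u\<close>.\<close>
  have "v \<rightarrow>\<^sup>*\<^bsub>with_proj (mk_symmetric (with_proj H))\<^esub> w"
    using assms(2) v w by (auto simp: Digraph_Component.connected_def strongly_connected_def)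
  then have "v \<rightarrow>\<^sup>*\<^bsub>with_proj H\<^esub> w"
    by (simp add: reachable_mk_symmetric_eq[OF pair_sym_arcs])
  then have "(v, w) \<in> (parcs H)\<^sup>*"
    by (auto simp: reachable_def intro: rtrancl_on_rtranclI)
  then show ?thesis using w(2) that by (metis converse_rtranclE)
qed

text \<open>A vertex common to \<open>H\<^sub>1\<close> and \<open>H\<^sub>2\<close> is
  \<open>v\<^sub>2\<close>, which lies in \<open>H\<^sub>0\<close>, and is therefore
  \<open>v\<^sub>1\<close>. This makes \<open>H\<^sub>1\<close> a single branch on the rest.\<close>

lemma double_vertex_sum_left:
  assumes "is_double_vertex_sum H\<^sub>1 v\<^sub>1 H\<^sub>0 v\<^sub>2 H\<^sub>2 G"
  shows "is_vertex_sum H\<^sub>1 v\<^sub>1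
    \<lparr>pverts = pverts H\<^sub>0 \<union> pverts H\<^sub>2, parcs = parcs H\<^sub>0 \<union> parcs H\<^sub>2\<rparr> G"
  using assms unfolding is_double_vertex_sum_def is_vertex_sum_def by auto

lemma double_vertex_sum_right:
  assumes "is_double_vertex_sum H\<^sub>1 v\<^sub>1 H\<^sub>0 v\<^sub>2 H\<^sub>2 G"
  shows "is_vertex_sum H\<^sub>2 v\<^sub>2
    \<lparr>pverts = pverts H\<^sub>1 \<union> pverts H\<^sub>0, parcs = parcs H\<^sub>1 \<union> parcs H\<^sub>0\<rparr> G"
  using assms unfolding is_double_vertex_sum_def is_vertex_sum_def by auto

lemma vertex_sum_pair_graph:
  assumes "is_vertex_sum H\<^sub>1 v H G" and "pair_graph H\<^sub>1" and "pair_graph H"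
  shows "pair_graph G"
  using pair_graph_union[OF assms(2,3)] assms(1) by (simp add: is_vertex_sum_def)

lemma SNIP_nullity_sum_exchange:
  assumes "pair_graph H" and "pair_graph H\<^sub>1" and "pair_graph H\<^sub>2"
    and "is_vertex_sum H\<^sub>1 v H G" and "is_vertex_sum H\<^sub>2 v H G'"
    and "(v, u) \<in> parcs H\<^sub>2" and "i \<in> pverts H"
    and "A \<in> graph_matrices G" and "SNIP (pverts G) i A"
    and "branch_nondegenerate (pverts H\<^sub>1 - {v}) v A"
    and "nullity_pair (pverts G) i A = (k, l)" and "k \<le> l"
  shows "k + l \<in> SNIP_sums G' i"
  using vertex_sum_exchange[OF assms(1-10)] assms(11,12) unfolding SNIP_sums_def by auto

lemma complete_2_pair_graph:
  assumes "complete_digraph 2 (with_proj K)" and "v \<in> pverts K"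
  obtains w where "w \<noteq> v" "pverts K = {v, w}" "(v, w) \<in> parcs K" "pair_graph K"
proof -
  have "card (pverts K) = 2"
    and arcs: "parcs K = {(u, v). (u, v) \<in> pverts K \<times> pverts K \<and> u \<noteq> v}"
    using assms(1) by (auto simp: complete_digraph_pair_def)
  then obtain w where w: "w \<noteq> v" "pverts K = {v, w}"
    using assms(2) by (metis card_2_iff doubleton_eq_iff insertE singletonD)
  moreover have "(v, w) \<in> parcs K" using arcs w by auto
  moreover have "pair_graph K" by (rule pair_graphI_complete) (rule assms(1))
  ultimately show ?thesis by (rule that)
qed

text \<open>On an edge from \<open>v\<close> to \<open>w\<close>, a vector that is zero at
  \<open>v\<close> has outflow \<open>A v w * y w\<close> with \<open>A v w \<noteq> 0\<close>. An
  edge is thus always nondegenerate and can be exchanged for \<open>H\<^sub>1\<close>.\<close>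

lemma SNIP_sums_vertex_sum_edge_subset:
  assumes "pair_graph H" and "pair_graph H\<^sub>1" and K: "complete_digraph 2 (with_proj K)"
    and "is_vertex_sum H\<^sub>1 v H G" and G': "is_vertex_sum K v H G'"
    and "(v, u) \<in> parcs H\<^sub>1" and "i \<in> pverts H"
  shows "SNIP_sums G' i \<subseteq> SNIP_sums G i"
proof
  fix n assume "n \<in> SNIP_sums G' i"
  then obtain k l A where n: "n = k + l" "k \<le> l" and A: "A \<in> graph_matrices G'"
    and snip: "SNIP (pverts G') i A" and pair: "nullity_pair (pverts G') i A = (k, l)"
    by (auto simp: SNIP_sums_def)
  have vK: "v \<in> pverts K" using G' by (auto simp: is_vertex_sum_def)
  obtain w where w: "w \<noteq> v" "pverts K = {v, w}" "(v, w) \<in> parcs K" "pair_graph K"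
    using complete_2_pair_graph[OF K vK] by blast
  have "A v w \<noteq> 0"
    using A G' w by (auto simp: graph_matrices_def is_vertex_sum_def)
  then have "y w = 0" if "y v = 0" "outflow {w} v A y = 0" for y
    using that w(1) by (simp add: outflow_def)
  moreover have "pverts K - {v} = {w}" using w by auto
  ultimately have "branch_nondegenerate (pverts K - {v}) v A"
    by (simp add: branch_nondegenerate_def)
  then show "n \<in> SNIP_sums G i"
    unfolding n(1)
    using SNIP_nullity_sum_exchange[OF assms(1) w(4) assms(2) G' assms(4,6,7) A snip _ pair n(2)]
    by blast
qed

theorem theorem5p5:
  fixes G G\<^sub>0 G\<^sub>1 G\<^sub>2 K L G' G'' :: "'a pair_pre_digraph" and v\<^sub>1 v\<^sub>2 i :: 'a
  assumes "pair_graph G\<^sub>0" and "pair_graph G\<^sub>1" and "pair_graph G\<^sub>2"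
    and "Digraph_Component.connected (with_proj G\<^sub>1)" and "card (pverts G\<^sub>1) \<ge> 2"
    and "Digraph_Component.connected (with_proj G\<^sub>2)" and "card (pverts G\<^sub>2) \<ge> 2"
    and "v\<^sub>1 \<in> pverts G\<^sub>0" and "v\<^sub>2 \<in> pverts G\<^sub>0"
    and "v\<^sub>1 \<in> pverts G\<^sub>1" and "v\<^sub>2 \<in> pverts G\<^sub>2"
    and "i \<in> pverts G\<^sub>0"
    and "complete_digraph 2 (with_proj K)" and "complete_digraph 2 (with_proj L)"
    and "is_double_vertex_sum G\<^sub>1 v\<^sub>1 G\<^sub>0 v\<^sub>2 G\<^sub>2 G"
    and "is_double_vertex_sum K v\<^sub>1 G\<^sub>0 v\<^sub>2 G\<^sub>2 G'"
    and "is_double_vertex_sum G\<^sub>1 v\<^sub>1 G\<^sub>0 v\<^sub>2 L G''"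
  shows "xixi G i = max (xixi G' i) (xixi G'' i)"
proof -
  interpret G0: pair_graph "G\<^sub>0" by (rule assms)
  interpret G1: pair_graph "G\<^sub>1" by (rule assms)
  interpret G2: pair_graph "G\<^sub>2" by (rule assms)
  \<comment> \<open>Each end is viewed as a branch on everything else: \<open>G\<^sub>1\<close> on
    \<open>P\<close>, \<open>G\<^sub>2\<close> on \<open>Q\<close>.\<close>
  define P where "P = \<lparr>pverts = pverts G\<^sub>0 \<union> pverts G\<^sub>2, parcs = parcs G\<^sub>0 \<union> parcs G\<^sub>2\<rparr>"
  define Q where "Q = \<lparr>pverts = pverts G\<^sub>1 \<union> pverts G\<^sub>0, parcs = parcs G\<^sub>1 \<union> parcs G\<^sub>0\<rparr>"
  have PQ: "pair_graph P" "pair_graph Q" "i \<in> pverts P" "i \<in> pverts Q"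
    using pair_graph_union assms(1-3,12) by (auto simp: P_def Q_def)
  have sums: "is_vertex_sum G\<^sub>1 v\<^sub>1 P G" "is_vertex_sum K v\<^sub>1 P G'"
      "is_vertex_sum G\<^sub>2 v\<^sub>2 Q G" "is_vertex_sum L v\<^sub>2 Q G''"
    using double_vertex_sum_left[OF assms(15)] double_vertex_sum_left[OF assms(16)]
      double_vertex_sum_right[OF assms(15)] double_vertex_sum_right[OF assms(17)]
    by (auto simp: P_def Q_def)
  obtain u1 where u1: "(v\<^sub>1, u1) \<in> parcs G\<^sub>1"
    using connected_obtains_neighbour[OF assms(2,4,5,10)] .
  obtain u2 where u2: "(v\<^sub>2, u2) \<in> parcs G\<^sub>2"
    using connected_obtains_neighbour[OF assms(3,6,7,11)] .
  have ends: "v\<^sub>1 \<in> pverts K" "v\<^sub>2 \<in> pverts L" using sums by (auto simp: is_vertex_sum_def)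
  obtain w1 where w1: "(v\<^sub>1, w1) \<in> parcs K" "pair_graph K"
    using complete_2_pair_graph[OF assms(13) ends(1)] by blast
  obtain w2 where w2: "(v\<^sub>2, w2) \<in> parcs L" "pair_graph L"
    using complete_2_pair_graph[OF assms(14) ends(2)] by blast
  have "SNIP_sums G' i \<union> SNIP_sums G'' i \<subseteq> SNIP_sums G i"
    using SNIP_sums_vertex_sum_edge_subset[OF PQ(1) assms(2,13) sums(1,2) u1 PQ(3)]
      SNIP_sums_vertex_sum_edge_subset[OF PQ(2) assms(3,14) sums(3,4) u2 PQ(4)] by blast
  moreover have "n \<in> SNIP_sums G' i \<union> SNIP_sums G'' i" if n_in: "n \<in> SNIP_sums G i" for n
  proof -
    obtain k l A where n: "n = k + l" "k \<le> l" and A: "A \<in> graph_matrices G"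
      and snip: "SNIP (pverts G) i A" and pair: "nullity_pair (pverts G) i A = (k, l)"
      using n_in by (auto simp: SNIP_sums_def)
    define W1 W2 where "W1 = pverts G\<^sub>1 - {v\<^sub>1}" and "W2 = pverts G\<^sub>2 - {v\<^sub>2}"
    have verts: "pverts G = pverts G\<^sub>1 \<union> pverts G\<^sub>0 \<union> pverts G\<^sub>2"
      and arcs: "parcs G = parcs G\<^sub>1 \<union> parcs G\<^sub>0 \<union> parcs G\<^sub>2"
      and int1: "pverts G\<^sub>1 \<inter> (pverts G\<^sub>0 \<union> pverts G\<^sub>2) = {v\<^sub>1}"
      and int2: "pverts G\<^sub>2 \<inter> (pverts G\<^sub>1 \<union> pverts G\<^sub>0) = {v\<^sub>2}"
      using sums(1,3) by (auto simp: is_vertex_sum_def P_def Q_def)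
    have fin: "finite (pverts G)"
      using verts G0.pair_finite_verts G1.pair_finite_verts G2.pair_finite_verts by simp
    have A0: "A p q = 0" if "p \<in> pverts G" "q \<in> pverts G" "p \<noteq> q" "(p, q) \<notin> parcs G" for p q
      using A that by (auto simp: graph_matrices_def)
    have in_verts: "p \<in> pverts G\<^sub>0 \<and> q \<in> pverts G\<^sub>0 \<or> p \<in> pverts G\<^sub>1 \<and> q \<in> pverts G\<^sub>1 \<or>
        p \<in> pverts G\<^sub>2 \<and> q \<in> pverts G\<^sub>2" if "(p, q) \<in> parcs G" for p q
      using that arcs G0.in_arcsD1 G0.in_arcsD2 G1.in_arcsD1 G1.in_arcsD2
        G2.in_arcsD1 G2.in_arcsD2 by blast
    have cut1: "A p q = 0" if "p \<in> pverts G - insert v\<^sub>1 W1" "q \<in> W1" for p q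
      using that A0[of p q] in_verts[of p q] verts int1 by (auto simp: W1_def)
    have cut2: "A p q = 0" if "p \<in> pverts G - insert v\<^sub>2 W2" "q \<in> W2" for p q
      using that A0[of p q] in_verts[of p q] verts int2 by (auto simp: W2_def)
    \<comment> \<open>This covers \<open>v\<^sub>1 = v\<^sub>2\<close>: the only vertex of
      \<open>G\<^sub>1\<close> in \<open>G\<^sub>0\<close> or \<open>G\<^sub>2\<close> is
      \<open>v\<^sub>1\<close>, which \<open>W1\<close> omits, and likewise at the other
      end.\<close>
    have disjoint: "W1 \<inter> insert v\<^sub>2 W2 = {}" "W2 \<inter> insert v\<^sub>1 W1 = {}"
      using int1 int2 assms(8,9) by (auto simp: W1_def W2_def)
    have sub: "insert v\<^sub>1 W1 \<subseteq> pverts G" "insert v\<^sub>2 W2 \<subseteq> pverts G"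
      using verts assms(8,9) by (auto simp: W1_def W2_def)
    have "branch_nondegenerate W1 v\<^sub>1 A \<or> branch_nondegenerate W2 v\<^sub>2 A"
    proof (rule ccontr)
      assume "\<not> ?thesis"
      then have deg: "\<not> branch_nondegenerate W1 v\<^sub>1 A" "\<not> branch_nondegenerate W2 v\<^sub>2 A" by auto
      have notin: "v\<^sub>1 \<notin> W1" "v\<^sub>2 \<notin> W2" by (auto simp: W1_def W2_def)
      obtain x where x: "x \<in> null_space (pverts G) A" "\<And>p. p \<notin> W1 \<Longrightarrow> x p = 0" "x \<noteq> 0"
        using degenerate_branch_null_vector[OF fin sub(1) notin(1) cut1 deg(1)] by blast
      obtain y where y: "y \<in> null_space (pverts G) A" "\<And>p. p \<notin> W2 \<Longrightarrow> y p = 0" "y \<noteq> 0"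
        using degenerate_branch_null_vector[OF fin sub(2) notin(2) cut2 deg(2)] by blast
      have "A p q = 0 \<and> A q p = 0" if "p \<in> W1" "q \<in> W2" for p q
        using that cut1[of q p] cut2[of p q] disjoint sub by auto
      then show False
        using SNIP_no_independent_null_vectors[OF snip _ _ x(1,2) y(1,2)] x(3) y(3) disjoint
        by blast
    qed
    \<comment> \<open>The nondegenerate branch is replaced by an edge: at \<open>v\<^sub>1\<close>
      this leads to \<open>G'\<close>, at \<open>v\<^sub>2\<close> to \<open>G''\<close>.\<close>
    then show ?thesis
      unfolding n(1) W1_def W2_def
      using SNIP_nullity_sum_exchange[OF PQ(1) assms(2) w1(2) sums(1,2) w1(1) PQ(3) A snip _ pair n(2)]
        SNIP_nullity_sum_exchange[OF PQ(2) assms(3) w2(2) sums(3,4) w2(1) PQ(4) A snip _ pair n(2)]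
      by blast
  qed
  ultimately have eq: "SNIP_sums G i = SNIP_sums G' i \<union> SNIP_sums G'' i" by blast
  have graphs: "pair_graph G'" "pair_graph G''"
    using vertex_sum_pair_graph[OF sums(2) w1(2) PQ(1)]
      vertex_sum_pair_graph[OF sums(4) w2(2) PQ(2)] by auto
  \<comment> \<open>The sum 0 is attained in both graphs, so the maximum of the union splits over
    two nonempty finite sets.\<close>
  have "i \<in> pverts G'" "i \<in> pverts G''" using sums PQ by (auto simp: is_vertex_sum_def)
  then have "SNIP_sums G' i \<noteq> {}" "SNIP_sums G'' i \<noteq> {}"
    using SNIP_sums_nonempty[OF graphs(1)] SNIP_sums_nonempty[OF graphs(2)] by auto
  then show ?thesis
    unfolding xixi_def eq
    by (rule Max_Un[OF finite_SNIP_sums[OF graphs(1)] _ finite_SNIP_sums[OF graphs(2)]])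
qed

end
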